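(* Let $f, g_i, h_j \in C^{1,1}(\mathbb{R}^n)$ for $i\in I=\{1,\dots,m\}$, $j\in J=\{1,\dots,p\}$, and consider the problem (P1) of minimizing $f(x)$ over $x\in X:=\{x\in\mathbb{R}^n\mid g_i(x)\le 0,\ i\in I,\ h_j(x)=0,\ j\in J\}$. Let $\bar x\in X$ be a stationary point of (P1) and $(\bar\lambda,\bar\mu)\in\Lambda(\bar x)$. Assume that for every $v\in[T(\bar x,X)\cap C(\bar x)]\setminus\{0\}$ and for any $z\in\partial^2\mathcal{L}(\bar x,\bar\lambda,\bar\mu)(v)$ one has $$\langle z,v\rangle>0.$$ Then $\bar x$ is an isolated local solution of order $2$ of (P1).
   Context: All spaces are finite-dimensional Euclidean spaces with inner product $\langle\cdot,\cdot\rangle$ and norm $\|\cdot\|$. $C^{1,1}(\mathbb{R}^n)$ is the class of real-valued Fréchet differentiable functions on $\mathbb{R}^n$ whose gradient mapping is locally Lipschitz. Active index set: $I^0(x):=\{i\in I\mid g_i(x)=0\}$. Cone of critical directions at $x\in X$: $$C(x):=\{v\in\mathbb{R}^n\mid\langle\nabla f(x),v\rangle=0,\ \langle\nabla g_i(x),v\rangle\le0,\ i\in I^0(x),\ \langle\nabla h_j(x),v\rangle=0,\ j\in J\}.$$ Contingent cone: for $\Omega\subset\mathbb{R}^n$ and $\bar x\in\Omega$, $v\in T(\bar x,\Omega)$ iff there exist $t_k\to0^+$ (with $t_k>0$) and $v_k\to v$ such that $\bar x+t_kv_k\in\Omega$ for every $k\in\mathbb{N}$. Lagrangian: $\mathcal{L}(x,\lambda,\mu)=f(x)+\sum_{i\in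 I}\lambda_ig_i(x)+\sum_{j\in J}\mu_jh_j(x)$. Set of Lagrange multipliers at $\bar x\in X$: $$\Lambda(\bar x):=\{(\bar\lambda,\bar\mu)\in\mathbb{R}^m_+\times\mathbb{R}^p\mid\nabla_x\mathcal{L}(\bar x,\bar\lambda,\bar\mu)=0,\ \bar\lambda_ig_i(\bar x)=0,\ i\in I\}.$$ A point $\bar x\in X$ is a stationary point of (P1) if $\Lambda(\bar x)\ne\emptyset$. Isolated local solution of order 2: a point $\bar x\in X$ for which there exist $\rho>0$ and a neighborhood $U$ of $\bar x$ such that $f(x)>f(\bar x)+\frac12\rho\|x-\bar x\|^2$ for all $x\in X\cap U$, $x\ne\bar x$. Normal cones: for $\Omega\subset\mathbb{R}^n$ and $\bar x\in\Omega$, the Fréchet normal cone is $\widehat N(\bar x,\Omega)=\{v\mid\limsup_{x\to\bar x,\,x\in\Omega}\langle v,x-\bar x\rangle/\|x-\bar x\|\le0\}$, and the limiting (Mordukhovich) normal cone $N(\bar x,\Omega)$ is the set of all $v$ for which there exist $x_k\to\bar x$, $x_k\in\Omega$, and $v_k\in\widehat N(x_k,\Omega)$ with $v_k\to v$. Limiting second-order subdifferential: for $\phi\in C^{1,1}(\mathbb{R}^n)$ (so that the limiting subdifferential $\partial\phi(x)$ equals $\{\nabla\phi(x)\}$), it is the limiting coderivative of the gradient mapping: $$\partial^2\phi(\bar x)(v)=\{u\in\mathbb{R}^n\mid(u,-v)\in N((\bar x,\nabla\phi(\bar x)),\mathrm{gph}\,\nabla\phi)\},\quad v\in\mathbb{R}^n.$$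 $\partial^2\mathcal{L}(\bar x,\bar\lambda,\bar\mu)(v)$ denotes the limiting second-order subdifferential at $\bar x$ of the function $x\mapsto\mathcal{L}(x,\bar\lambda,\bar\mu)$, evaluated at $v$. *)

theory Defs
  imports "HOL-Analysis.Analysis"
begin

definition grad :: "('a::real_inner \<Rightarrow> real) \<Rightarrow> 'a \<Rightarrow> 'a" where
  "grad f x = (THE D. GDERIV f x :> D)"

definition C11 :: "('a::real_inner \<Rightarrow> real) \<Rightarrow> bool" where
  "C11 f \<longleftrightarrow>
     (\<forall>x. f differentiable (at x)) \<and>
     (\<forall>x. \<exists>r>0. \<exists>L. L-lipschitz_on (cball x r) (grad f))"

definition contingent_cone :: "'a::real_normed_vector \<Rightarrow> 'a set \<Rightarrow> 'a set" where
  "contingent_cone x S =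
     {v. \<exists>(t :: nat \<Rightarrow> real) (w :: nat \<Rightarrow> 'a).
           (\<forall>k. t k > 0) \<and> t \<longlonglongrightarrow> 0 \<and> w \<longlonglongrightarrow> v \<and> (\<forall>k. x + t k *\<^sub>R w k \<in> S)}"

(* If x is an isolated point of S, then at x within S = bot, the Limsup is -\<infinity>,
   and every v is a normal. *)
definition frechet_normal_cone :: "'a::real_inner \<Rightarrow> 'a set \<Rightarrow> 'a set" where
  "frechet_normal_cone x S =
     {v. Limsup (at x within S) (\<lambda>y. ereal (inner v (y - x) / norm (y - x))) \<le> 0}"

definition limiting_normal_cone :: "'a::real_inner \<Rightarrow> 'a set \<Rightarrow> 'a set" where
  "limiting_normal_cone x S =
     {v. \<exists>(y :: nat \<Rightarrow> 'a) (w :: nat \<Rightarrow> 'a).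
           y \<longlonglongrightarrow> x \<and> (\<forall>k. y k \<in> S) \<and>
           (\<forall>k. w k \<in> frechet_normal_cone (y k) S) \<and> w \<longlonglongrightarrow> v}"

definition limiting_coderivative ::
    "('a::real_inner \<Rightarrow> 'b::real_inner) \<Rightarrow> 'a \<Rightarrow> 'b \<Rightarrow> 'a set" where
  "limiting_coderivative F x v =
     {u. (u, - v) \<in> limiting_normal_cone (x, F x) (range (\<lambda>y. (y, F y)))}"

(* Only meant for \<phi> with C11 \<phi>, whose limiting subdifferential is the singleton
   of the gradient. *)
definition second_order_subdifferential ::
    "('a::real_inner \<Rightarrow> real) \<Rightarrow> 'a \<Rightarrow> 'a \<Rightarrow> 'a set" where
  "second_order_subdifferential \<phi> x v = limiting_coderivative (grad \<phi>) x v"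

(* The constraint families are indexed by {1..m} and {1..p}, where m and p may be 0;
   the values of g and h at other indices are irrelevant. *)
definition feasible_set ::
    "nat \<Rightarrow> nat \<Rightarrow> (nat \<Rightarrow> 'a \<Rightarrow> real) \<Rightarrow> (nat \<Rightarrow> 'a \<Rightarrow> real) \<Rightarrow> 'a set" where
  "feasible_set m p g h = {x. (\<forall>i\<in>{1..m}. g i x \<le> 0) \<and> (\<forall>j\<in>{1..p}. h j x = 0)}"

definition active_set :: "nat \<Rightarrow> (nat \<Rightarrow> 'a \<Rightarrow> real) \<Rightarrow> 'a \<Rightarrow> nat set" where
  "active_set m g x = {i\<in>{1..m}. g i x = 0}"

definition critical_cone ::
    "nat \<Rightarrow> nat \<Rightarrow> ('a::real_inner \<Rightarrow> real) \<Rightarrow> (nat \<Rightarrow> 'a \<Rightarrow> real) \<Rightarrow> (nat \<Rightarrow> 'a \<Rightarrow> real) \<Rightarrow> 'a \<Rightarrow> 'a set"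
  where
  "critical_cone m p f g h x =
     {v. inner (grad f x) v = 0 \<and>
         (\<forall>i\<in>active_set m g x. inner (grad (g i) x) v \<le> 0) \<and>
         (\<forall>j\<in>{1..p}. inner (grad (h j) x) v = 0)}"

definition lagrangian ::
    "nat \<Rightarrow> nat \<Rightarrow> ('a \<Rightarrow> real) \<Rightarrow> (nat \<Rightarrow> 'a \<Rightarrow> real) \<Rightarrow> (nat \<Rightarrow> 'a \<Rightarrow> real)
      \<Rightarrow> 'a \<Rightarrow> (nat \<Rightarrow> real) \<Rightarrow> (nat \<Rightarrow> real) \<Rightarrow> real" where
  "lagrangian m p f g h x l u =
     f x + (\<Sum>i\<in>{1..m}. l i * g i x) + (\<Sum>j\<in>{1..p}. u j * h j x)"

(* The extensional function spaces represent the nonnegative orthant of \<real>\<^sup>m and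
   the space \<real>\<^sup>p, so m and p can be arbitrary natural numbers (including 0). *)
definition lagrange_multipliers ::
    "nat \<Rightarrow> nat \<Rightarrow> ('a::real_inner \<Rightarrow> real) \<Rightarrow> (nat \<Rightarrow> 'a \<Rightarrow> real) \<Rightarrow> (nat \<Rightarrow> 'a \<Rightarrow> real)
      \<Rightarrow> 'a \<Rightarrow> ((nat \<Rightarrow> real) \<times> (nat \<Rightarrow> real)) set" where
  "lagrange_multipliers m p f g h x =
     {(l, u). l \<in> {1..m} \<rightarrow>\<^sub>E {0..} \<and> u \<in> {1..p} \<rightarrow>\<^sub>E UNIV \<and>
              grad (\<lambda>y. lagrangian m p f g h y l u) x = 0 \<and>
              (\<forall>i\<in>{1..m}. l i * g i x = 0)}"

definition stationary_point ::
    "nat \<Rightarrow> nat \<Rightarrow> ('a::real_inner \<Rightarrow> real) \<Rightarrow> (nat \<Rightarrow> 'a \<Rightarrow> real) \<Rightarrow> (nat \<Rightarrow> 'a \<Rightarrow> real) \<Rightarrow> 'a \<Rightarrow> bool"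
  where
  "stationary_point m p f g h x \<longleftrightarrow>
     x \<in> feasible_set m p g h \<and> lagrange_multipliers m p f g h x \<noteq> {}"

definition isolated_local_solution_order2 ::
    "('a::real_normed_vector \<Rightarrow> real) \<Rightarrow> 'a set \<Rightarrow> 'a \<Rightarrow> bool" where
  "isolated_local_solution_order2 f X x \<longleftrightarrow>
     x \<in> X \<and>
     (\<exists>\<rho>>0. \<exists>U. open U \<and> x \<in> U \<and>
        (\<forall>y \<in> X \<inter> U. y \<noteq> x \<longrightarrow> f y > f x + 1/2 * \<rho> * (norm (y - x))\<^sup>2))"

end

theory Submission
  imports Defs
begin

text \<open>
  Suppose that quadratic growth fails at \<open>xbar\<close>. Then there are feasible points
  \<open>xbar + t\<^sub>k w\<^sub>k\<close> with positive \<open>t\<^sub>k\<close> tending to \<open>0\<close> and \<open>w\<^sub>k\<close> tending to some \<open>v \<noteq> 0\<close> at which \<open>f\<close> exceeds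
  \<open>f xbar\<close> by at most \<open>o(t\<^sub>k\<^sup>2)\<close> (lemma \<open>not_isolated_local_solution_sequence\<close>). The limit \<open>v\<close> is
  tangent to the feasible set. First-order expansions show that every active inequality
  constraint and \<open>f\<close> itself have nonpositive slope along \<open>v\<close>, and that the equality constraints
  have slope zero; stationarity of the Lagrangian then forces the slope of \<open>f\<close> to vanish, so
  \<open>v\<close> is critical. Since the Lagrangian \<open>\<phi>\<close> lies below \<open>f\<close> on the feasible set and agrees with it at
  \<open>xbar\<close>, also \<open>\<phi> (xbar + t\<^sub>k w\<^sub>k) \<le> \<phi> xbar + o(t\<^sub>k\<^sup>2)\<close>.

  The hypothesis is contradicted by producing \<open>z\<close> in the second-order subdifferential of
  \<open>\<phi>\<close> in direction \<open>v\<close> with \<open>\<langle>z, v\<rangle> \<le> 0\<close> (lemma \<open>exists_nonpos_second_order_subgradient\<close>). This rests on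
  two observations about the scalar functions \<open>\<psi>\<^sub>k = \<langle>w\<^sub>k, \<nabla>\<phi>\<rangle>\<close>, which are Lipschitz near \<open>xbar\<close> and
  vanish at \<open>xbar\<close>. By the classical mean value theorem applied to \<open>\<phi>\<close>, the function \<open>\<psi>\<^sub>k\<close> increases
  from \<open>xbar\<close> to some \<open>xbar + s w\<^sub>k\<close>, where \<open>0 < s < t\<^sub>k\<close>, by at most \<open>o(1) s\<close>; a second,
  nonsmooth mean value theorem (lemma \<open>approximate_mean_value\<close>) applied to \<open>\<psi>\<^sub>k\<close> then yields a
  proximal subgradient \<open>z\<^sub>k\<close> of \<open>\<psi>\<^sub>k\<close> at a nearby point with \<open>\<langle>z\<^sub>k, w\<^sub>k\<rangle> \<le> o(1)\<close>. And a proximal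
  subgradient \<open>z\<close> of \<open>\<langle>w, \<nabla>\<phi>\<rangle>\<close> gives the Frechet normal \<open>(z, -w)\<close> to the graph of \<open>\<nabla>\<phi>\<close> (lemma
  \<open>graph_frechet_normal\<close>). The \<open>z\<^sub>k\<close> are bounded in terms of the Lipschitz constant, so a subsequence
  converges, and its limit is the required \<open>z\<close>.
\<close>

section \<open>Gradients and the class of functions with locally Lipschitz gradient\<close>

lemma grad_eq:
  assumes "GDERIV f x :> D"
  shows "grad f x = D"
  unfolding grad_def
proof (rule the_equality)
  fix D' assume "GDERIV f x :> D'"
  then have "(\<lambda>h. inner h D') = (\<lambda>h. inner h D)"
    using assms unfolding gderiv_def by (rule has_derivative_unique)
  then show "D' = D" by (metis vector_eq_ldot)
qed (rule assms)

text \<open>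
  In a Euclidean space every bounded linear functional is an inner product with a fixed vector,
  which is the adjoint applied to \<open>1\<close>; hence differentiability already provides a gradient.
\<close>
lemma GDERIV_grad:
  fixes f :: "'a::euclidean_space \<Rightarrow> real"
  assumes "f differentiable (at x)"
  shows "GDERIV f x :> grad f x"
proof -
  obtain D where D: "(f has_derivative D) (at x)"
    using assms differentiable_def by blast
  have "D h = inner h (adjoint D 1)" for h
    using adjoint_works[of D h 1] has_derivative_linear[OF D] by simp
  then have "D = (\<lambda>h. inner h (adjoint D 1))" by blast
  with D have "GDERIV f x :> adjoint D 1"
    unfolding gderiv_def by metis
  then show ?thesis using grad_eq by metis
qed

lemma C11_GDERIV:
  fixes f :: "'a::euclidean_space \<Rightarrow> real"
  shows "C11 f \<Longrightarrow> GDERIV f x :> grad f x"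
  by (simp add: C11_def GDERIV_grad)

lemma C11_I:
  fixes f :: "'a::real_inner \<Rightarrow> real"
  assumes "\<And>x. GDERIV f x :> G x"
    and "\<And>x. \<exists>r>0. \<exists>L. L-lipschitz_on (cball x r) G"
  shows "C11 f"
proof -
  have "grad f = G" using assms(1) grad_eq by blast
  then show ?thesis
    using assms unfolding C11_def differentiable_def gderiv_def by metis
qed

lemma C11_add:
  fixes f g :: "'a::euclidean_space \<Rightarrow> real"
  assumes "C11 f" "C11 g"
  shows "C11 (\<lambda>x. f x + g x)"
proof (rule C11_I)
  show "GDERIV (\<lambda>x. f x + g x) x :> grad f x + grad g x" for x
    using assms by (intro GDERIV_add C11_GDERIV)
  fix x
  obtain r L where 1: "r > 0" "L-lipschitz_on (cball x r) (grad f)"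
    using assms(1) unfolding C11_def by blast
  obtain r' L' where 2: "r' > 0" "L'-lipschitz_on (cball x r') (grad g)"
    using assms(2) unfolding C11_def by blast
  have "(L + L')-lipschitz_on (cball x (min r r')) (\<lambda>x. grad f x + grad g x)"
    using 1 2 by (intro lipschitz_on_add) (auto elim!: lipschitz_on_subset)
  with 1 2 show "\<exists>r>0. \<exists>L. L-lipschitz_on (cball x r) (\<lambda>x. grad f x + grad g x)"
    by (metis min_less_iff_conj)
qed

lemma C11_cmult:
  fixes f :: "'a::euclidean_space \<Rightarrow> real"
  assumes "C11 f"
  shows "C11 (\<lambda>x. c * f x)"
proof (rule C11_I)
  show "GDERIV (\<lambda>x. c * f x) x :> c *\<^sub>R grad f x" for x
    using GDERIV_mult[OF GDERIV_const C11_GDERIV[OF assms]] by simp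
  fix x
  obtain r L where 1: "r > 0" "L-lipschitz_on (cball x r) (grad f)"
    using assms unfolding C11_def by blast
  then have "(\<bar>c\<bar> * L)-lipschitz_on (cball x r) (\<lambda>x. c *\<^sub>R grad f x)"
    by (intro lipschitz_on_cmult) auto
  with 1 show "\<exists>r>0. \<exists>L. L-lipschitz_on (cball x r) (\<lambda>x. c *\<^sub>R grad f x)"
    by blast
qed

lemma C11_zero: "C11 (\<lambda>x :: 'a::real_inner. 0)"
proof (rule C11_I)
  show "GDERIV (\<lambda>x. 0 :: real) x :> 0" for x :: 'a
    by (rule GDERIV_const)
  have "0-lipschitz_on (cball x 1) (\<lambda>_. 0 :: 'a)" for x :: 'a
    by (rule lipschitz_onI) auto
  then show "\<exists>r>0. \<exists>L. L-lipschitz_on (cball x r) (\<lambda>_. 0 :: 'a)" for x :: 'a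
    using zero_less_one by blast
qed

lemma C11_sum:
  fixes F :: "'i \<Rightarrow> 'a::euclidean_space \<Rightarrow> real"
  shows "(\<And>i. i \<in> A \<Longrightarrow> C11 (F i)) \<Longrightarrow> C11 (\<lambda>x. \<Sum>i\<in>A. F i x)"
  by (induction A rule: infinite_finite_induct) (auto intro: C11_zero C11_add)

lemma GDERIV_sum:
  assumes "\<And>i. i \<in> A \<Longrightarrow> GDERIV (F i) x :> G i"
  shows "GDERIV (\<lambda>x. \<Sum>i\<in>A. F i x) x :> (\<Sum>i\<in>A. G i)"
  using assms
  by (induction A rule: infinite_finite_induct) (auto intro: GDERIV_const GDERIV_add)

lemma C11_lagrangian:
  fixes f :: "'a::euclidean_space \<Rightarrow> real"
  assumes "C11 f" "\<And>i. i \<in> {1..m} \<Longrightarrow> C11 (g i)" "\<And>j. j \<in> {1..p} \<Longrightarrow> C11 (h j)"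
  shows "C11 (\<lambda>x. lagrangian m p f g h x l u)"
  unfolding lagrangian_def using assms
  by (intro C11_add C11_sum C11_cmult) auto

lemma grad_lagrangian:
  fixes f :: "'a::euclidean_space \<Rightarrow> real"
  assumes "C11 f" "\<And>i. i \<in> {1..m} \<Longrightarrow> C11 (g i)" "\<And>j. j \<in> {1..p} \<Longrightarrow> C11 (h j)"
  shows "grad (\<lambda>x. lagrangian m p f g h x l u) x =
    grad f x + (\<Sum>i\<in>{1..m}. l i *\<^sub>R grad (g i) x) + (\<Sum>j\<in>{1..p}. u j *\<^sub>R grad (h j) x)"
proof (rule grad_eq)
  have c: "GDERIV (\<lambda>x. c * k x) x :> c *\<^sub>R grad k x" if "C11 k" for c and k :: "'a \<Rightarrow> real"
    using GDERIV_mult[OF GDERIV_const C11_GDERIV[OF that]] by simp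
  show "GDERIV (\<lambda>x. lagrangian m p f g h x l u) x :> grad f x
     + (\<Sum>i\<in>{1..m}. l i *\<^sub>R grad (g i) x) + (\<Sum>j\<in>{1..p}. u j *\<^sub>R grad (h j) x)"
    unfolding lagrangian_def using assms
    by (intro GDERIV_add GDERIV_sum c C11_GDERIV) auto
qed

text \<open>
  Frechet differentiability allows the direction to vary with the step length. This is what
  transfers information from points \<open>x + t\<^sub>k w\<^sub>k\<close> to the limiting direction \<open>v\<close>.
\<close>
lemma difference_quotient_tendsto:
  fixes F :: "'a::real_inner \<Rightarrow> real"
  assumes D: "GDERIV F x :> D" and tpos: "\<And>k. t k > 0"
    and t: "t \<longlonglongrightarrow> 0" and w: "w \<longlonglongrightarrow> v"
  shows "(\<lambda>k. (F (x + t k *\<^sub>R w k) - F x) / t k) \<longlonglongrightarrow> inner D v"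
proof -
  define q where "q y = (F y - F x - inner (y - x) D) / norm (y - x)" for y
  have "(q \<longlongrightarrow> 0) (at x)"
    using D unfolding gderiv_def has_derivative_at_within q_def
    by (simp add: divide_inverse mult.commute)
  \<comment> \<open>Division by zero gives \<open>q x = 0\<close>, so \<open>q\<close> is continuous at \<open>x\<close>; this covers those \<open>k\<close>
      for which \<open>w k = 0\<close>, where the sequence of points meets \<open>x\<close>.\<close>
  then have "isCont q x" by (simp add: isCont_def q_def)
  moreover have "(\<lambda>k. x + t k *\<^sub>R w k) \<longlonglongrightarrow> x"
    using tendsto_add[OF tendsto_const tendsto_scaleR[OF t w], of x] by simp
  ultimately have "(\<lambda>k. q (x + t k *\<^sub>R w k)) \<longlonglongrightarrow> q x"
    by (rule isCont_tendsto_compose)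
  then have "(\<lambda>k. q (x + t k *\<^sub>R w k)) \<longlonglongrightarrow> 0" by (simp add: q_def)
  then have "(\<lambda>k. q (x + t k *\<^sub>R w k) * norm (w k) + inner (w k) D) \<longlonglongrightarrow> 0 * norm v + inner v D"
    by (intro tendsto_intros w)
  moreover have "q (x + t k *\<^sub>R w k) * norm (w k) + inner (w k) D
      = (F (x + t k *\<^sub>R w k) - F x) / t k" for k
    using tpos[of k] by (cases "w k = 0") (auto simp: q_def field_simps)
  ultimately show ?thesis by (simp add: inner_commute)
qed

section \<open>Proximal subgradients\<close>

text \<open>
  Proximal subgradients are Frechet subgradients with a quadratic error term. They are what
  minimising a function with a quadratic penalty produces.
\<close>
definition proximal_subdifferential :: "('a::real_inner \<Rightarrow> real) \<Rightarrow> 'a \<Rightarrow> 'a set" where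
  "proximal_subdifferential \<psi> x =
     {z. \<exists>\<sigma>. \<forall>\<^sub>F y in nhds x. \<psi> y \<ge> \<psi> x + inner z (y - x) - \<sigma> * (norm (y - x))\<^sup>2}"

text \<open>
  A nonsmooth mean value inequality in the spirit of Zagrodny. The idea is to minimise
  \<open>\<psi> y + M \<parallel>y - \<pi> s\<parallel>\<^sup>2 - r s\<close> jointly over \<open>y\<close> in the ball and over the parameter \<open>s\<close> of a point
  \<open>\<pi> s\<close> on the segment from \<open>a\<close> to \<open>b\<close>. Minimality in \<open>y\<close> says that \<open>z = 2 M (\<pi> s - y)\<close> is a
  proximal subgradient at \<open>y\<close>. Minimality in \<open>s\<close> compares the slope \<open>\<langle>z, b - a\<rangle>\<close> with \<open>r\<close>: to the
  left of \<open>s\<close> the objective is not smaller, and this gives \<open>\<langle>z, b - a\<rangle> \<le> r\<close> as soon as \<open>s \<noteq> 0\<close>.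
  The minimiser cannot have \<open>s = 0\<close>, because \<open>\<psi> b - r < \<psi> a\<close> makes the endpoint \<open>b\<close> strictly better
  than every point near \<open>a\<close>. The Lipschitz bound forces \<open>M \<parallel>y - \<pi> s\<parallel> \<le> K\<close>, which at once bounds \<open>z\<close>
  and, for large \<open>M\<close>, keeps \<open>y\<close> close to the segment.
\<close>
lemma approximate_mean_value:
  fixes \<psi> :: "'a::euclidean_space \<Rightarrow> real"
  assumes lip: "K-lipschitz_on (cball c R) \<psi>"
    and a: "a \<in> ball c R" and b: "b \<in> ball c R"
    and less: "\<psi> b - \<psi> a < r"
  shows "\<exists>y\<in>ball c R. \<exists>z\<in>proximal_subdifferential \<psi> y. norm z \<le> 2 * K \<and> inner z (b - a) \<le> r"
proof -
  define \<delta> where "\<delta> = R - max (dist c a) (dist c b)"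
  define gap where "gap = r - (\<psi> b - \<psi> a)"
  \<comment> \<open>The first bound on \<open>M\<close> keeps the minimiser inside the open ball; the second one excludes
      the parameter \<open>s = 0\<close>.\<close>
  define M where "M = max ((K + 1) / \<delta>) ((K\<^sup>2 + 1) / gap)"
  define \<pi> where "\<pi> s = a + s *\<^sub>R (b - a)" for s
  define G where "G = (\<lambda>(y, s). \<psi> y + M * (norm (y - \<pi> s))\<^sup>2 - r * s)"
  have K: "K \<ge> 0" using lip lipschitz_on_nonneg by blast
  have \<delta>: "\<delta> > 0" using a b by (auto simp: \<delta>_def)
  have gap: "gap > 0" using less by (simp add: gap_def)
  have M1: "K + 1 \<le> M * \<delta>"
    using \<delta> by (simp add: M_def flip: pos_divide_le_eq)
  have M2: "K\<^sup>2 + 1 \<le> M * gap"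
    using gap by (simp add: M_def flip: pos_divide_le_eq)
  have M: "M > 0"
    using M1 K \<delta> by (smt (verit) zero_less_mult_pos2)
  have R: "R > 0" using a by (metis dist_not_less_zero le_less_trans linorder_not_le mem_ball)
  have \<pi>c: "dist c (\<pi> s) \<le> R - \<delta>" if "s \<in> {0..1}" for s
  proof -
    have "\<pi> s \<in> closed_segment a b"
      using that by (auto simp: \<pi>_def closed_segment_def algebra_simps intro!: exI[of _ s])
    moreover have "closed_segment a b \<subseteq> cball c (R - \<delta>)"
      by (intro closed_segment_subset) (auto simp: \<delta>_def)
    ultimately show ?thesis by auto
  qed
  have "compact (cball c R \<times> {0..1::real})" by (intro compact_Times) auto
  moreover have "cball c R \<times> {0..1::real} \<noteq> {}" using R by auto
  moreover have "continuous_on (cball c R \<times> {0..1::real}) G"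
    unfolding G_def case_prod_beta \<pi>_def
    by (intro continuous_intros continuous_on_compose2[OF lipschitz_on_continuous_on[OF lip]]) auto
  ultimately obtain q where q: "q \<in> cball c R \<times> {0..1::real}"
    and qmin: "\<And>q'. q' \<in> cball c R \<times> {0..1::real} \<Longrightarrow> G q \<le> G q'"
    using continuous_attains_inf[of "cball c R \<times> {0..1::real}" G] by blast
  obtain y s where ys: "q = (y, s)" by fastforce
  have y: "y \<in> cball c R" and s: "s \<in> {0..1}" using q ys by auto
  have miny: "\<psi> y + M * (norm (y - \<pi> s))\<^sup>2 \<le> \<psi> y' + M * (norm (y' - \<pi> s))\<^sup>2"
    if "y' \<in> cball c R" for y'
    using qmin[of "(y', s)"] that s ys by (simp add: G_def)
  have mins: "M * (norm (y - \<pi> s))\<^sup>2 - r * s \<le> M * (norm (y - \<pi> s'))\<^sup>2 - r * s'"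
    if "s' \<in> {0..1}" for s'
    using qmin[of "(y, s')"] that y ys by (simp add: G_def)
  have \<pi>R: "\<pi> s \<in> cball c R" using \<pi>c[OF s] \<delta> by auto
  have lipy: "\<bar>\<psi> (\<pi> s) - \<psi> y\<bar> \<le> K * norm (y - \<pi> s)"
    using lipschitz_onD[OF lip y \<pi>R] by (simp add: dist_norm abs_minus_commute)
  \<comment> \<open>Compare the minimiser \<open>y\<close> with the competitor \<open>\<pi> s\<close>.\<close>
  have "M * norm (y - \<pi> s) * norm (y - \<pi> s) \<le> K * norm (y - \<pi> s)"
    using miny[OF \<pi>R] lipy by (simp add: power2_eq_square)
  then have near: "M * norm (y - \<pi> s) \<le> K"
    using K by (cases "y = \<pi> s") auto
  have "M * norm (y - \<pi> s) < M * \<delta>" using near M1 by linarith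
  then have "norm (y - \<pi> s) < \<delta>" using M by simp
  then have yball: "y \<in> ball c R"
    using \<pi>c[OF s] dist_triangle[of c y "\<pi> s"] by (simp add: dist_norm norm_minus_commute)
  define z where "z = (2 * M) *\<^sub>R (\<pi> s - y)"
  have "z \<in> proximal_subdifferential \<psi> y"
  proof -
    have "\<psi> y' \<ge> \<psi> y + inner z (y' - y) - M * (norm (y' - y))\<^sup>2" if "y' \<in> ball c R" for y'
    proof -
      have "(norm (y' - \<pi> s))\<^sup>2
          = (norm (y' - y))\<^sup>2 - 2 * inner (\<pi> s - y) (y' - y) + (norm (y - \<pi> s))\<^sup>2"
        unfolding power2_norm_eq_inner by (simp add: algebra_simps inner_commute)
      moreover have "inner z (y' - y) = M * (2 * inner (\<pi> s - y) (y' - y))"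
        by (simp add: z_def)
      ultimately have "M * (norm (y' - \<pi> s))\<^sup>2
          = M * (norm (y' - y))\<^sup>2 - inner z (y' - y) + M * (norm (y - \<pi> s))\<^sup>2"
        by (simp only: distrib_left right_diff_distrib)
      then show ?thesis using miny[of y'] that by simp
    qed
    moreover have "\<forall>\<^sub>F y' in nhds y. y' \<in> ball c R"
      using yball by (intro eventually_nhds_in_open) auto
    ultimately show ?thesis
      unfolding proximal_subdifferential_def mem_Collect_eq
      by (intro exI[of _ M]) (auto elim: eventually_mono)
  qed
  moreover have "norm z \<le> 2 * K"
    using near M by (simp add: z_def norm_minus_commute)
  moreover have "inner z (b - a) \<le> r"
  proof -
    have "s \<noteq> 0"
    proof
      assume "s = 0"
      then have "\<pi> s = a" by (simp add: \<pi>_def)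
      then have "\<psi> y \<ge> \<psi> a - K * norm (y - \<pi> s)" using lipy by simp
      moreover have "\<psi> y + M * (norm (y - \<pi> s))\<^sup>2 \<le> \<psi> b - r"
        using qmin[of "(b, 1)"] b ys \<open>s = 0\<close> by (simp add: G_def \<pi>_def)
      ultimately have "gap \<le> K * norm (y - \<pi> s)"
        using M by (smt (verit) gap_def mult_nonneg_nonneg zero_le_power2)
      then have "M * gap \<le> K * (M * norm (y - \<pi> s))"
        using mult_left_mono[of gap "K * norm (y - \<pi> s)" M] M by (simp add: mult.left_commute)
      also have "\<dots> \<le> K * K" using near K by (intro mult_left_mono)
      finally show False using M2 by (simp add: power2_eq_square)
    qed
    with s have s01: "0 < s" "s \<le> 1" by auto
    define N where "N = M * (norm (b - a))\<^sup>2"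
    \<comment> \<open>Moving the parameter from \<open>s\<close> back to \<open>s - \<eta>\<close> does not decrease the objective.\<close>
    have ineq: "inner z (b - a) \<le> r + N * \<eta>" if \<eta>: "0 < \<eta>" "\<eta> \<le> s" for \<eta>
    proof -
      have shift: "y - \<pi> (s - \<eta>) = (y - \<pi> s) + \<eta> *\<^sub>R (b - a)"
        by (simp add: \<pi>_def algebra_simps)
      have "(norm (y - \<pi> (s - \<eta>)))\<^sup>2
          = (norm (y - \<pi> s))\<^sup>2 - \<eta> * (2 * inner (\<pi> s - y) (b - a)) + \<eta>\<^sup>2 * (norm (b - a))\<^sup>2"
        unfolding shift power2_norm_eq_inner
        by (simp add: inner_commute power2_eq_square algebra_simps)
      moreover have "inner z (b - a) = M * (2 * inner (\<pi> s - y) (b - a))"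
        by (simp add: z_def)
      ultimately have "M * (norm (y - \<pi> (s - \<eta>)))\<^sup>2
          = M * (norm (y - \<pi> s))\<^sup>2 - \<eta> * inner z (b - a) + \<eta>\<^sup>2 * N"
        by (simp only: N_def distrib_left right_diff_distrib mult.left_commute)
      moreover have "s - \<eta> \<in> {0..1}" using \<eta> s01 by auto
      ultimately have "\<eta> * inner z (b - a) \<le> \<eta> * (r + N * \<eta>)"
        using mins[of "s - \<eta>"] by (simp add: algebra_simps power2_eq_square)
      then show ?thesis using \<eta> by simp
    qed
    have "((\<lambda>\<eta>. r + N * \<eta>) \<longlongrightarrow> r + N * 0) (at_right 0)"
      by (intro tendsto_intros)
    moreover have "\<forall>\<^sub>F \<eta> in at_right 0. inner z (b - a) \<le> r + N * \<eta>"
      using ineq s01 unfolding eventually_at_right_field by (intro exI[of _ s]) auto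
    ultimately show ?thesis
      by (metis add.right_neutral mult_zero_right tendsto_lowerbound trivial_limit_at_right_real)
  qed
  ultimately show ?thesis using yball by blast
qed

section \<open>Second-order subgradients along directions\<close>

lemma proximal_normal_imp_frechet_normal:
  fixes x :: "'a::real_inner"
  assumes "\<forall>\<^sub>F y in at x within S. inner v (y - x) \<le> \<sigma> * (norm (y - x))\<^sup>2"
  shows "v \<in> frechet_normal_cone x S"
proof -
  have "\<forall>\<^sub>F y in at x within S. ereal (inner v (y - x) / norm (y - x)) < e" if "e > 0" for e :: ereal
  proof -
    have "((\<lambda>y. \<sigma> * norm (y - x)) \<longlongrightarrow> \<sigma> * norm (x - x)) (at x within S)"
      by (intro tendsto_intros)
    then have "((\<lambda>y. ereal (\<sigma> * norm (y - x))) \<longlongrightarrow> 0) (at x within S)"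
      by (simp add: zero_ereal_def)
    then have "\<forall>\<^sub>F y in at x within S. ereal (\<sigma> * norm (y - x)) < e"
      using that by (rule order_tendstoD)
    moreover have "\<forall>\<^sub>F y in at x within S. y \<noteq> x"
      by (simp add: eventually_at_filter)
    ultimately show ?thesis using assms
    proof eventually_elim
      case (elim y)
      then have "inner v (y - x) / norm (y - x) \<le> \<sigma> * norm (y - x)"
        by (simp add: pos_divide_le_eq power2_eq_square mult.assoc)
      then show ?case using elim(1) by (meson ereal_less_eq(3) le_less_trans)
    qed
  qed
  then show ?thesis
    unfolding frechet_normal_cone_def by (simp add: Limsup_le_iff)
qed

text \<open>
  Along the graph of \<open>F\<close> the functional \<open>(z, -w)\<close> measures \<open>\<langle>z, y' - y\<rangle> - (\<langle>w, F y'\<rangle> - \<langle>w, F y\<rangle>)\<close>, which a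
  proximal subgradient \<open>z\<close> of \<open>\<langle>w, F\<rangle>\<close> bounds by a multiple of \<open>\<parallel>y' - y\<parallel>\<^sup>2\<close>. The distance in the
  graph is at least \<open>\<parallel>y' - y\<parallel>\<close>, so this error is quadratic there as well.
\<close>
lemma graph_frechet_normal:
  fixes F :: "'a::real_inner \<Rightarrow> 'b::real_inner"
  assumes "z \<in> proximal_subdifferential (\<lambda>x. inner w (F x)) y"
  shows "(z, - w) \<in> frechet_normal_cone (y, F y) (range (\<lambda>y. (y, F y)))"
proof -
  obtain \<sigma> where \<sigma>: "\<forall>\<^sub>F y' in nhds y.
      inner w (F y') \<ge> inner w (F y) + inner z (y' - y) - \<sigma> * (norm (y' - y))\<^sup>2"
    using assms unfolding proximal_subdifferential_def by blast
  let ?S = "range (\<lambda>y. (y, F y))"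
  have "filterlim fst (nhds y) (at (y, F y) within ?S)"
    using tendsto_fst[OF tendsto_ident_at, of "(y, F y)" ?S] by simp
  from eventually_compose_filterlim[OF \<sigma> this]
  have "\<forall>\<^sub>F q in at (y, F y) within ?S.
      inner w (F (fst q)) \<ge> inner w (F y) + inner z (fst q - y) - \<sigma> * (norm (fst q - y))\<^sup>2" .
  moreover have "\<forall>\<^sub>F q in at (y, F y) within ?S. q \<in> ?S"
    by (simp add: eventually_at_filter)
  ultimately have "\<forall>\<^sub>F q in at (y, F y) within ?S.
      inner (z, - w) (q - (y, F y)) \<le> \<bar>\<sigma>\<bar> * (norm (q - (y, F y)))\<^sup>2"
  proof eventually_elim
    case (elim q)
    then obtain y' where q: "q = (y', F y')" by blast
    have "inner (z, - w) (q - (y, F y)) \<le> \<sigma> * (norm (y' - y))\<^sup>2"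
      using elim(1) by (simp add: q inner_diff_right)
    also have "\<dots> \<le> \<bar>\<sigma>\<bar> * (norm (y' - y))\<^sup>2" by (intro mult_right_mono) auto
    also have "\<dots> \<le> \<bar>\<sigma>\<bar> * (norm (q - (y, F y)))\<^sup>2"
      using norm_fst_le[of "y' - y" "F y' - F y"]
      by (intro mult_left_mono power_mono) (auto simp: q)
    finally show ?case .
  qed
  then show ?thesis by (rule proximal_normal_imp_frechet_normal)
qed

text \<open>
  The quantitative step at a single point \<open>x + t w\<close>. The smooth mean value theorem for
  \<open>\<phi> (x + s w) - e s\<^sup>2\<close> gives \<open>s \<in> (0, t)\<close> with \<open>\<langle>w, \<nabla>\<phi> (x + s w)\<rangle> \<le> 2 e s\<close>, and the nonsmooth one for
  \<open>\<langle>w, \<nabla>\<phi>\<rangle>\<close> on the segment from \<open>x\<close> to \<open>x + s w\<close> converts this into a bound on a subgradient. The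
  slack \<open>d\<close> provides the strict inequality required by the latter, and the factor
  \<open>norm w + 1\<close> makes the ball contain the segment in its interior.
\<close>
lemma subgradient_from_growth:
  fixes \<phi> :: "'a::euclidean_space \<Rightarrow> real"
  assumes der: "\<And>x. GDERIV \<phi> x :> grad \<phi> x"
    and lip: "L-lipschitz_on (cball x r) (grad \<phi>)"
    and stat: "grad \<phi> x = 0"
    and t: "t > 0" "t * (norm w + 1) \<le> r"
    and le: "\<phi> (x + t *\<^sub>R w) \<le> \<phi> x + e * t\<^sup>2"
    and d: "d > 0"
  shows "\<exists>y\<in>ball x (t * (norm w + 1)). \<exists>z\<in>proximal_subdifferential (\<lambda>y. inner w (grad \<phi> y)) y.
           norm z \<le> 2 * (norm w * L) \<and> inner z w \<le> 2 * e + d"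
proof -
  define \<theta> where "\<theta> s = \<phi> (x + s *\<^sub>R w) - e * s\<^sup>2" for s
  have "(\<theta> has_real_derivative inner w (grad \<phi> (x + s *\<^sub>R w)) - 2 * e * s) (at s)" for s
  proof -
    have 1: "((\<lambda>s. x + s *\<^sub>R w) has_derivative (\<lambda>h. h *\<^sub>R w)) (at s)"
      by (auto intro!: derivative_eq_intros)
    have "((\<lambda>s. \<phi> (x + s *\<^sub>R w)) has_derivative (\<lambda>h. inner (h *\<^sub>R w) (grad \<phi> (x + s *\<^sub>R w)))) (at s)"
      using has_derivative_compose[OF 1 der[unfolded gderiv_def]] by simp
    then have "((\<lambda>s. \<phi> (x + s *\<^sub>R w)) has_real_derivative inner w (grad \<phi> (x + s *\<^sub>R w))) (at s)"
      by (rule has_derivative_imp_has_field_derivative) simp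
    then show ?thesis unfolding \<theta>_def by (auto intro!: derivative_eq_intros)
  qed
  from MVT2[OF t(1) this] obtain s where s: "0 < s" "s < t"
    and "\<theta> t - \<theta> 0 = (t - 0) * (inner w (grad \<phi> (x + s *\<^sub>R w)) - 2 * e * s)"
    by auto
  moreover have "\<theta> t \<le> \<theta> 0" using le by (simp add: \<theta>_def)
  ultimately have "t * (inner w (grad \<phi> (x + s *\<^sub>R w)) - 2 * e * s) \<le> t * 0" by simp
  then have mv: "inner w (grad \<phi> (x + s *\<^sub>R w)) \<le> 2 * e * s"
    unfolding mult_le_cancel_left_pos[OF t(1)] by simp
  let ?R = "t * (norm w + 1)"
  have "(norm w * L)-lipschitz_on (cball x ?R) (\<lambda>y. inner w (grad \<phi> y))"
  proof (rule lipschitz_onI)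
    fix y y' assume "y \<in> cball x ?R" "y' \<in> cball x ?R"
    then have "dist (grad \<phi> y) (grad \<phi> y') \<le> L * dist y y'"
      using t(2) by (intro lipschitz_onD[OF lip]) auto
    then have "norm w * dist (grad \<phi> y) (grad \<phi> y') \<le> norm w * (L * dist y y')"
      by (intro mult_left_mono) auto
    moreover have "dist (inner w (grad \<phi> y)) (inner w (grad \<phi> y'))
        \<le> norm w * dist (grad \<phi> y) (grad \<phi> y')"
      using Cauchy_Schwarz_ineq2[of w "grad \<phi> y - grad \<phi> y'"]
      by (simp add: dist_norm inner_diff_right)
    ultimately show "dist (inner w (grad \<phi> y)) (inner w (grad \<phi> y')) \<le> norm w * L * dist y y'"
      by simp
  qed (use lipschitz_on_nonneg[OF lip] in simp)
  moreover have "x \<in> ball x ?R" using t(1) by (simp add: add_nonneg_pos)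
  moreover have "x + s *\<^sub>R w \<in> ball x ?R"
  proof -
    have "s * norm w \<le> t * norm w" using s by (intro mult_right_mono) auto
    then show ?thesis using s t(1) by (simp add: dist_norm distrib_left)
  qed
  moreover have "inner w (grad \<phi> (x + s *\<^sub>R w)) - inner w (grad \<phi> x) < (2 * e + d) * s"
    using mv stat mult_pos_pos[OF d s(1)] by (simp add: algebra_simps)
  ultimately have "\<exists>y\<in>ball x ?R. \<exists>z\<in>proximal_subdifferential (\<lambda>y. inner w (grad \<phi> y)) y.
      norm z \<le> 2 * (norm w * L) \<and> inner z (x + s *\<^sub>R w - x) \<le> (2 * e + d) * s"
    by (intro approximate_mean_value)
  moreover have "inner z (x + s *\<^sub>R w - x) \<le> (2 * e + d) * s \<longleftrightarrow> inner z w \<le> 2 * e + d" for z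
    using mult_le_cancel_right_pos[OF s(1), of "inner z w" "2 * e + d"]
    by (simp add: mult.commute)
  ultimately show ?thesis by (simp only:)
qed

text \<open>
  A second-order necessary condition: if \<open>\<phi>\<close> grows at most like \<open>o(t\<^sub>k\<^sup>2)\<close> from its stationary point
  \<open>x\<close> along directions tending to \<open>v\<close>, then its second-order subdifferential in direction \<open>v\<close>
  contains an element of nonpositive curvature. It is obtained as a limit of the subgradients of
  the previous lemma, which are bounded because \<open>\<nabla>\<phi>\<close> is Lipschitz near \<open>x\<close>.
\<close>
lemma exists_nonpos_second_order_subgradient:
  fixes \<phi> :: "'a::euclidean_space \<Rightarrow> real"
  assumes C11: "C11 \<phi>" and stat: "grad \<phi> x = 0"
    and tpos: "\<And>k. t k > 0" and t: "t \<longlonglongrightarrow> 0" and w: "w \<longlonglongrightarrow> v" and e: "e \<longlonglongrightarrow> 0"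
    and le: "\<And>k. \<phi> (x + t k *\<^sub>R w k) \<le> \<phi> x + e k * (t k)\<^sup>2"
  shows "\<exists>z\<in>second_order_subdifferential \<phi> x v. inner z v \<le> 0"
proof -
  obtain r L where r: "r > 0" and lip: "L-lipschitz_on (cball x r) (grad \<phi>)"
    using C11 unfolding C11_def by blast
  define R where "R k = t k * (norm (w k) + 1)" for k
  have "R \<longlonglongrightarrow> 0 * (norm v + 1)"
    unfolding R_def by (intro tendsto_intros t w)
  then have R: "R \<longlonglongrightarrow> 0" by simp
  obtain B where B: "\<And>k. norm (w k) \<le> B"
    using convergent_imp_Bseq[OF convergentI[OF w]] by (auto simp: Bseq_def)
  \<comment> \<open>The Lipschitz bound is only local, so the sequences are shifted by an index \<open>N\<close>
      from which on the balls of radius \<open>R k\<close> lie in its domain.\<close>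
  have "\<forall>\<^sub>F k in sequentially. R k < r" using R r by (rule order_tendstoD)
  then obtain N where N: "\<And>k. R (k + N) < r"
    unfolding eventually_sequentially by (metis le_add2)
  have "\<exists>y z. y \<in> ball x (R (k + N)) \<and>
      z \<in> proximal_subdifferential (\<lambda>y. inner (w (k + N)) (grad \<phi> y)) y \<and>
      norm z \<le> 2 * (norm (w (k + N)) * L) \<and>
      inner z (w (k + N)) \<le> 2 * e (k + N) + inverse (real (Suc k))" for k
    using subgradient_from_growth[OF C11_GDERIV[OF C11] lip stat tpos _ le, of "k + N" "inverse (real (Suc k))"]
      N[of k] unfolding R_def by force
  then obtain y z where y: "\<And>k. y k \<in> ball x (R (k + N))"
    and z: "\<And>k. z k \<in> proximal_subdifferential (\<lambda>y. inner (w (k + N)) (grad \<phi> y)) (y k)"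
    and znorm: "\<And>k. norm (z k) \<le> 2 * (norm (w (k + N)) * L)"
    and zw: "\<And>k. inner (z k) (w (k + N)) \<le> 2 * e (k + N) + inverse (real (Suc k))"
    by metis
  have L: "L \<ge> 0" using lip lipschitz_on_nonneg by blast
  have "norm (z k) \<le> 2 * (B * L)" for k
    using znorm[of k] mult_right_mono[OF B L, of "k + N"] by linarith
  then have "bounded (range z)" by (intro boundedI) auto
  then obtain \<zeta> \<sigma> where \<sigma>: "strict_mono \<sigma>" and \<zeta>: "(z \<circ> \<sigma>) \<longlonglongrightarrow> \<zeta>"
    using bounded_imp_convergent_subsequence by blast
  have sub: "filterlim (\<lambda>k. \<sigma> k + N) sequentially sequentially"
    using filterlim_subseq[OF \<sigma>] by (intro filterlim_compose[OF filterlim_add_const_nat_at_top])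
  have w': "(\<lambda>k. w (\<sigma> k + N)) \<longlonglongrightarrow> v" by (rule filterlim_compose[OF w sub])
  have e': "(\<lambda>k. e (\<sigma> k + N)) \<longlonglongrightarrow> 0" by (rule filterlim_compose[OF e sub])
  have R': "(\<lambda>k. R (\<sigma> k + N)) \<longlonglongrightarrow> 0" by (rule filterlim_compose[OF R sub])
  have y': "(\<lambda>k. y (\<sigma> k)) \<longlonglongrightarrow> x"
  proof (rule metric_tendsto_imp_tendsto[OF R'], rule always_eventually, rule allI)
    show "dist (y (\<sigma> k)) x \<le> dist (R (\<sigma> k + N)) 0" for k
      using y[of "\<sigma> k"] by (simp add: dist_commute)
  qed
  have "(\<lambda>k. 2 * e (\<sigma> k + N) + inverse (real (Suc (\<sigma> k)))) \<longlonglongrightarrow> 2 * 0 + 0"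
    by (intro tendsto_intros e' filterlim_compose[OF LIMSEQ_inverse_real_of_nat filterlim_subseq[OF \<sigma>]])
  moreover have "(\<lambda>k. inner (z (\<sigma> k)) (w (\<sigma> k + N))) \<longlonglongrightarrow> inner \<zeta> v"
    using \<zeta> by (intro tendsto_intros w') (simp add: o_def)
  ultimately have "inner \<zeta> v \<le> 0"
    using zw by (intro LIMSEQ_le[of _ "inner \<zeta> v" _ 0]) auto
  moreover have "\<zeta> \<in> second_order_subdifferential \<phi> x v"
    unfolding second_order_subdifferential_def limiting_coderivative_def limiting_normal_cone_def
      mem_Collect_eq
  proof (intro exI conjI allI)
    have "isCont (grad \<phi>) x"
      using lipschitz_on_continuous_on[OF lip] r
      by (simp add: continuous_on_interior)
    then show "(\<lambda>k. (y (\<sigma> k), grad \<phi> (y (\<sigma> k)))) \<longlonglongrightarrow> (x, grad \<phi> x)"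
      by (intro tendsto_Pair y' isCont_tendsto_compose[OF _ y'])
    show "(z (\<sigma> k), - w (\<sigma> k + N)) \<in> frechet_normal_cone (y (\<sigma> k), grad \<phi> (y (\<sigma> k)))
        (range (\<lambda>y. (y, grad \<phi> y)))" for k
      by (rule graph_frechet_normal[OF z])
    show "(\<lambda>k. (z (\<sigma> k), - w (\<sigma> k + N))) \<longlonglongrightarrow> (\<zeta>, - v)"
      using \<zeta> by (intro tendsto_intros w') (simp add: o_def)
  qed auto
  ultimately show ?thesis by blast
qed

section \<open>The sufficient condition\<close>

text \<open>
  Growth with modulus \<open>\<rho> = 2 / (k + 1)\<close> fails on the ball of radius \<open>1 / (k + 1)\<close> for each \<open>k\<close>.
  Normalising the displacements of the violating points puts the directions on the unit sphere,
  where a subsequence converges.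
\<close>
lemma not_isolated_local_solution_sequence:
  fixes f :: "'a::euclidean_space \<Rightarrow> real"
  assumes "x \<in> X" and not: "\<not> isolated_local_solution_order2 f X x"
  shows "\<exists>t w v e. (\<forall>k. t k > 0) \<and> t \<longlonglongrightarrow> 0 \<and> w \<longlonglongrightarrow> v \<and> v \<noteq> 0 \<and> e \<longlonglongrightarrow> (0::real) \<and>
    (\<forall>k::nat. x + t k *\<^sub>R w k \<in> X \<and> f (x + t k *\<^sub>R w k) \<le> f x + e k * (t k)\<^sup>2)"
proof -
  have "\<exists>y. y \<in> X \<and> dist x y < inverse (real (Suc k)) \<and> y \<noteq> x \<and>
      f y \<le> f x + inverse (real (Suc k)) * (norm (y - x))\<^sup>2" for k
  proof (rule ccontr)
    assume no: "\<not> ?thesis"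
    have "isolated_local_solution_order2 f X x"
      unfolding isolated_local_solution_order2_def
    proof (intro conjI exI)
      show "0 < 2 * inverse (real (Suc k))" by simp
      show "x \<in> ball x (inverse (real (Suc k)))" by simp
      show "\<forall>y\<in>X \<inter> ball x (inverse (real (Suc k))). y \<noteq> x \<longrightarrow>
          f x + 1 / 2 * (2 * inverse (real (Suc k))) * (norm (y - x))\<^sup>2 < f y"
        using no by (auto simp: not_le)
    qed (use assms in auto)
    with not show False by blast
  qed
  then obtain y where yX: "\<And>k. y k \<in> X" and yx: "\<And>k. dist x (y k) < inverse (real (Suc k))"
    and ne: "\<And>k. y k \<noteq> x" and fy: "\<And>k. f (y k) \<le> f x + inverse (real (Suc k)) * (norm (y k - x))\<^sup>2"
    by metis
  define t where "t k = norm (y k - x)" for k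
  define w where "w k = (y k - x) /\<^sub>R t k" for k
  have tpos: "t k > 0" for k using ne by (simp add: t_def)
  have yk: "y k = x + t k *\<^sub>R w k" for k using tpos[of k] by (simp add: w_def)
  have t: "t \<longlonglongrightarrow> 0"
  proof (rule metric_tendsto_imp_tendsto[OF LIMSEQ_inverse_real_of_nat],
      rule always_eventually, rule allI)
    show "dist (t k) 0 \<le> dist (inverse (real (Suc k))) 0" for k
      using yx[of k] by (simp add: t_def dist_norm norm_minus_commute)
  qed
  have w1: "norm (w k) = 1" for k using ne[of k] by (simp add: w_def t_def)
  then have "bounded (range w)" by (intro boundedI[of _ 1]) auto
  then obtain v \<sigma> where \<sigma>: "strict_mono \<sigma>" and v: "(w \<circ> \<sigma>) \<longlonglongrightarrow> v"
    using bounded_imp_convergent_subsequence by blast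
  have "(\<lambda>k. norm ((w \<circ> \<sigma>) k)) \<longlonglongrightarrow> norm v" using v by (rule tendsto_norm)
  then have "norm v = 1" using w1 by (simp add: LIMSEQ_const_iff)
  moreover have "(t \<circ> \<sigma>) \<longlonglongrightarrow> 0" using t \<sigma> by (rule LIMSEQ_subseq_LIMSEQ)
  moreover have "((\<lambda>k. inverse (real (Suc k))) \<circ> \<sigma>) \<longlonglongrightarrow> 0"
    using LIMSEQ_inverse_real_of_nat \<sigma> by (rule LIMSEQ_subseq_LIMSEQ)
  moreover have "\<forall>k. x + (t \<circ> \<sigma>) k *\<^sub>R (w \<circ> \<sigma>) k \<in> X \<and> f (x + (t \<circ> \<sigma>) k *\<^sub>R (w \<circ> \<sigma>) k)
      \<le> f x + ((\<lambda>k. inverse (real (Suc k))) \<circ> \<sigma>) k * ((t \<circ> \<sigma>) k)\<^sup>2"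
    using yX fy by (simp add: yk[symmetric] del: of_nat_Suc) (simp add: t_def)
  ultimately show ?thesis
    using v tpos by (intro exI[of _ "t \<circ> \<sigma>"] exI[of _ "w \<circ> \<sigma>"] exI[of _ v]
        exI[of _ "(\<lambda>k. inverse (real (Suc k))) \<circ> \<sigma>"]) auto
qed

theorem theorem4p1:
  fixes f :: "real ^ 'n \<Rightarrow> real"
    and g h :: "nat \<Rightarrow> real ^ 'n \<Rightarrow> real"
    and m p :: nat
    and xbar :: "real ^ 'n"
    and l u :: "nat \<Rightarrow> real"
  assumes "C11 f"
    and "\<And>i. i \<in> {1..m} \<Longrightarrow> C11 (g i)"
    and "\<And>j. j \<in> {1..p} \<Longrightarrow> C11 (h j)"
    and "xbar \<in> feasible_set m p g h"
    and "stationary_point m p f g h xbar"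
    and "(l, u) \<in> lagrange_multipliers m p f g h xbar"
    and "\<And>v z. v \<in> (contingent_cone xbar (feasible_set m p g h) \<inter> critical_cone m p f g h xbar) - {0} \<Longrightarrow>
           z \<in> second_order_subdifferential (\<lambda>x. lagrangian m p f g h x l u) xbar v \<Longrightarrow>
           inner z v > 0"
  shows "isolated_local_solution_order2 f (feasible_set m p g h) xbar"
proof (rule ccontr)
  let ?X = "feasible_set m p g h"
  let ?\<phi> = "\<lambda>x. lagrangian m p f g h x l u"
  assume "\<not> ?thesis"
  from not_isolated_local_solution_sequence[OF assms(4) this]
  obtain t w v e where tpos: "\<And>k. t k > 0" and t: "t \<longlonglongrightarrow> 0" and w: "w \<longlonglongrightarrow> v"
    and v: "v \<noteq> 0" and e: "e \<longlonglongrightarrow> (0::real)"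
    and X: "\<And>k::nat. xbar + t k *\<^sub>R w k \<in> ?X"
    and fle: "\<And>k. f (xbar + t k *\<^sub>R w k) \<le> f xbar + e k * (t k)\<^sup>2"
    by blast
  have l: "\<And>i. i \<in> {1..m} \<Longrightarrow> l i \<ge> 0" and lg: "\<And>i. i \<in> {1..m} \<Longrightarrow> l i * g i xbar = 0"
    and stat: "grad ?\<phi> xbar = 0"
    using assms(6) unfolding lagrange_multipliers_def by auto
  note quot = difference_quotient_tendsto[OF C11_GDERIV tpos t w]
  \<comment> \<open>The limit direction \<open>v\<close> is critical.\<close>
  have gv: "inner (grad (g i) xbar) v \<le> 0" if "i \<in> active_set m g xbar" for i
  proof (rule LIMSEQ_le[OF quot tendsto_const])
    show "C11 (g i)" using that assms(2) by (simp add: active_set_def)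
    have "g i (xbar + t k *\<^sub>R w k) \<le> 0" "g i xbar = 0" for k
      using that X[of k] by (auto simp: active_set_def feasible_set_def)
    then show "\<exists>N. \<forall>k\<ge>N. (g i (xbar + t k *\<^sub>R w k) - g i xbar) / t k \<le> 0"
      using tpos by (simp add: divide_nonpos_pos)
  qed
  have hv: "inner (grad (h j) xbar) v = 0" if "j \<in> {1..p}" for j
  proof -
    have quot0: "(h j (xbar + t k *\<^sub>R w k) - h j xbar) / t k = 0" for k
      using that X[of k] assms(4) by (simp add: feasible_set_def)
    then show ?thesis
      using quot[OF assms(3)[OF that], of xbar] unfolding quot0 by (simp add: LIMSEQ_const_iff)
  qed
  have "inner (grad f xbar) v \<le> 0"
  proof (rule LIMSEQ_le[OF quot[OF assms(1)]])
    show "(\<lambda>k. e k * t k) \<longlonglongrightarrow> 0" using tendsto_mult[OF e t] by simp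
    show "\<exists>N. \<forall>k\<ge>N. (f (xbar + t k *\<^sub>R w k) - f xbar) / t k \<le> e k * t k"
      using fle tpos by (simp add: pos_divide_le_eq power2_eq_square mult.assoc diff_le_eq add.commute)
  qed
  \<comment> \<open>The reverse inequality uses stationarity of the Lagrangian together with the sign and
      complementarity conditions on the multipliers.\<close>
  moreover have "inner (grad f xbar) v \<ge> 0"
  proof -
    have "l i * inner (grad (g i) xbar) v \<le> 0" if "i \<in> {1..m}" for i
    proof (cases "g i xbar = 0")
      case True
      then show ?thesis using gv[of i] l that
        by (simp add: active_set_def mult_nonneg_nonpos)
    next
      case False
      then show ?thesis using lg[OF that] by simp
    qed
    then have "(\<Sum>i\<in>{1..m}. l i * inner (grad (g i) xbar) v) \<le> 0" by (rule sum_nonpos)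
    moreover have "(\<Sum>j\<in>{1..p}. u j * inner (grad (h j) xbar) v) = 0" using hv by simp
    moreover have "inner (grad ?\<phi> xbar) v = inner (grad f xbar) v
        + (\<Sum>i\<in>{1..m}. l i * inner (grad (g i) xbar) v)
        + (\<Sum>j\<in>{1..p}. u j * inner (grad (h j) xbar) v)"
      by (subst grad_lagrangian[OF assms(1-3)]) (simp_all add: inner_add_left inner_sum_left)
    ultimately show ?thesis using stat by simp
  qed
  ultimately have "v \<in> critical_cone m p f g h xbar"
    using gv hv by (simp add: critical_cone_def)
  moreover have "v \<in> contingent_cone xbar ?X"
    unfolding contingent_cone_def using tpos t w X by blast
  moreover have "\<exists>z\<in>second_order_subdifferential ?\<phi> xbar v. inner z v \<le> 0"
  proof (rule exists_nonpos_second_order_subgradient[OF _ stat tpos t w e])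
    show "C11 ?\<phi>" by (rule C11_lagrangian[OF assms(1-3)])
    have below: "?\<phi> x \<le> f x" if "x \<in> ?X" for x
    proof -
      have "(\<Sum>i\<in>{1..m}. l i * g i x) \<le> 0"
        using that l by (intro sum_nonpos) (auto simp: feasible_set_def mult_nonneg_nonpos)
      moreover have "(\<Sum>j\<in>{1..p}. u j * h j x) = 0" using that by (simp add: feasible_set_def)
      ultimately show ?thesis by (simp add: lagrangian_def)
    qed
    have "(\<Sum>i\<in>{1..m}. l i * g i xbar) = 0" using lg by (intro sum.neutral) blast
    then have "?\<phi> xbar = f xbar"
      using assms(4) by (simp add: lagrangian_def feasible_set_def)
    then show "?\<phi> (xbar + t k *\<^sub>R w k) \<le> ?\<phi> xbar + e k * (t k)\<^sup>2" for k
      using below[OF X[of k]] fle[of k] by simp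
  qed
  ultimately show False using assms(7) v by (meson DiffI IntI linorder_not_le singletonD)
qed

end
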